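(* Let $A_1,A_2\in\mathbb{R}^{n\times n}$ and $B\in\mathbb{R}^{n\times m}$ be given, and let $\tau$ be a continuous time-varying delay with $\tau(t)\in[0,\bar\tau]$, where $\bar\tau\ge 0$. Suppose there exist positive constants $b$ and $h$, a positive definite matrix $Q\in\mathbb{R}^{n\times n}$, and a matrix $R\in\mathbb{R}^{m\times n}$ such that $$\begin{bmatrix} QA_1^\top+A_1Q+R^\top B^\top+BR+(b+h)Q & A_2Q\\ QA_2^\top & -bQ\end{bmatrix}<0 .$$ Set $P=Q^{-1}$ and $K=RP$, and let the constants $\alpha>0$ and $\sigma\geq 0$ be selected so that $h>\alpha+\sigma$. Then, for arbitrary $\beta>0$, the event-triggered control system $$\dot x(t)=A_1x(t)+A_2x(t-\tau(t))+Bu(t),\qquad u(t)=Kx(t_k)\ \text{ for } t\in[t_k,t_{k+1}),\ k\in\mathbb{N},$$ with event times $\{t_k\}_{k\in\mathbb{N}}$ determined by the triggering rule (with parameters $P,K,\alpha,\beta,\sigma$) described in the context, is globally exponentially stable and does not exhibit Zeno behavior. If it is further assumed that $\beta\leq\lambda$, where $\lambda$ is the unique real solution of the equation $$b+h-\sigma=b e^{\lambda\bar\tau}+\lambda+\alpha,$$ then the inter-event times $\{t_{k+1}-t_k\}_{k\in\mathbb{N}}$ are uniformly lower bounded by a positive quantity $\Delta$, that is, $t_{k+1}-t_k\geq\Delta>0$ for all $k\in\mathbb{N}$.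
   Context: $\mathbb{N}$ is the set of non-negative integers, $\mathbb{R}^+$ the set of non-negative reals, and $\|\cdot\|$ the Euclidean norm. For a symmetric matrix $M$, $M<0$ means that $M$ is negative definite; positive definite matrices are taken to be symmetric. System: $t\in\mathbb{R}^+$, with initial condition $x(s)=\phi(s)$ for $s\in[-\bar\tau,0]$, where $\phi:[-\bar\tau,0]\to\mathbb{R}^n$ is continuous. The first event time is $t_0=0$. Sampling error: $\epsilon(t)=x(t_k)-x(t)$ for $t\in[t_k,t_{k+1})$, $k\in\mathbb{N}$. Triggering rule: let $V(t)=x^\top(t)Px(t)$, let $V_0(s)=x^\top(s)Px(s)$ for $s\in[-\bar\tau,0]$, and let $\|V_0\|_{\bar\tau}=\sup_{-\bar\tau\le s\le 0}V(s)$. The event times are determined by $$t_{k+1}=\inf\{t>t_k:\ \mathcal{C}(x(t),\epsilon(t))\geq\zeta(t)\},$$ where $$\mathcal{C}(x(t),\epsilon(t))=2x^\top(t)PBK\epsilon(t)-\sigma x^\top(t)Px(t),\qquad \zeta(t)=\alpha\|V_0\|_{\bar\tau}e^{-\beta t}.$$ In this rule $\epsilon(t)=x(t_k)-x(t)$ is formed with the most recent event time $t_k$. The inter-event times are the differences $t_{k+1}-t_k$. Zeno behavior means that infinitely many event times occur in some finite time interval. Global exponential stability (standard meaning): there exist constants $M,\gamma>0$ such that for every continuous initial function $\phi$ the solution satisfies $\|x(t)\|\le M\sup_{s\in[-\bar\tau,0]}\|\phi(s)\|\,e^{-\gamma t}$ for all $t\geq 0$.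
   Formalization: For the zero initial function the triggering rule would give t_k = 0 for all k, so the claims fail; in this case alone the formal statement takes t_0 = 0 to be the only event. For every other initial function the rule is as stated. *)

theory Defs
  imports "HOL-Analysis.Analysis"
begin

definition pos_def :: "real ^ 'n ^ 'n \<Rightarrow> bool" where
  "pos_def M \<longleftrightarrow> transpose M = M \<and> (\<forall>v. v \<noteq> 0 \<longrightarrow> v \<bullet> (M *v v) > 0)"

definition neg_def :: "real ^ 'n ^ 'n \<Rightarrow> bool" where
  "neg_def M \<longleftrightarrow> transpose M = M \<and> (\<forall>v. v \<noteq> 0 \<longrightarrow> v \<bullet> (M *v v) < 0)"

definition block_matrix ::
    "real ^ 'n ^ 'n \<Rightarrow> real ^ 'n ^ 'n \<Rightarrow> real ^ 'n ^ 'n \<Rightarrow> real ^ 'n ^ 'n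
      \<Rightarrow> real ^ ('n + 'n) ^ ('n + 'n)" where
  "block_matrix M11 M12 M21 M22 =
     (\<chi> i j. case i of
        Inl p \<Rightarrow> (case j of Inl q \<Rightarrow> M11 $ p $ q | Inr q \<Rightarrow> M12 $ p $ q)
      | Inr p \<Rightarrow> (case j of Inl q \<Rightarrow> M21 $ p $ q | Inr q \<Rightarrow> M22 $ p $ q))"

definition quad_form :: "real ^ 'n ^ 'n \<Rightarrow> real ^ 'n \<Rightarrow> real" where
  "quad_form P v = v \<bullet> (P *v v)"

definition trigger_fun ::
    "real ^ 'n ^ 'n \<Rightarrow> real ^ 'm ^ 'n \<Rightarrow> real ^ 'n ^ 'm \<Rightarrow> real
      \<Rightarrow> real ^ 'n \<Rightarrow> real ^ 'n \<Rightarrow> real" where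
  "trigger_fun P B K \<sigma> v e = 2 * (v \<bullet> ((P ** B ** K) *v e)) - \<sigma> * quad_form P v"

definition trigger_threshold ::
    "real ^ 'n ^ 'n \<Rightarrow> real \<Rightarrow> real \<Rightarrow> real \<Rightarrow> (real \<Rightarrow> real ^ 'n) \<Rightarrow> real \<Rightarrow> real" where
  "trigger_threshold P \<alpha> \<beta> r \<phi> s = \<alpha> * (SUP \<theta>\<in>{-r..0}. quad_form P (\<phi> \<theta>)) * exp (- \<beta> * s)"

text \<open>
  The event following the event time \<open>e\<close>, for a trajectory \<open>x\<close> defined on \<open>[-r, T)\<close>.
  The value is \<open>\<infinity>\<close> (no further event) if the triggering condition is never met again.
  For the zero initial function the threshold vanishes identically, the condition
  \<open>0 \<ge> 0\<close> holds at every instant, and the infimum would give \<open>e\<close> itself, so that all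
  event times would be \<open>0\<close> and no trajectory would exist beyond time \<open>0\<close>.  In this
  case alone we use the convention that the initial event is the only one.
\<close>

definition next_event ::
    "real ^ 'n ^ 'n \<Rightarrow> real ^ 'm ^ 'n \<Rightarrow> real ^ 'n ^ 'm \<Rightarrow> real \<Rightarrow> real \<Rightarrow> real \<Rightarrow> real
      \<Rightarrow> (real \<Rightarrow> real ^ 'n) \<Rightarrow> (real \<Rightarrow> real ^ 'n) \<Rightarrow> ereal \<Rightarrow> ereal \<Rightarrow> ereal" where
  "next_event P B K \<alpha> \<beta> \<sigma> r \<phi> x T e =
     (if \<forall>\<theta>\<in>{-r..0}. \<phi> \<theta> = 0 then \<infinity>
      else Inf {ereal s | s. e < ereal s \<and> ereal s < T \<and>
                  trigger_fun P B K \<sigma> (x s) (x (real_of_ereal e) - x s)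
                    \<ge> trigger_threshold P \<alpha> \<beta> r \<phi> s})"

text \<open>
  \<open>etc_solution A1 A2 B P K \<tau> r \<alpha> \<beta> \<sigma> \<phi> x t\<close>: the function \<open>x\<close> with event times \<open>t\<close> is a
  maximal trajectory of the event-triggered closed loop with maximal delay \<open>r\<close> and initial
  function \<open>\<phi>\<close>.  Its interval of existence is \<open>[-r, T)\<close>, where \<open>T\<close> is the supremum of the
  event times.  Nothing is assumed about \<open>T\<close> beyond \<open>T > 0\<close>: it is finite exactly when event
  times accumulate, and values of \<open>x\<close> outside \<open>[-r, T)\<close> are irrelevant.  An event time \<open>\<infinity>\<close>
  means that there are only finitely many events.
\<close>

definition etc_solution ::
    "real ^ 'n ^ 'n \<Rightarrow> real ^ 'n ^ 'n \<Rightarrow> real ^ 'm ^ 'n \<Rightarrow> real ^ 'n ^ 'n \<Rightarrow> real ^ 'n ^ 'm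
      \<Rightarrow> (real \<Rightarrow> real) \<Rightarrow> real \<Rightarrow> real \<Rightarrow> real \<Rightarrow> real
      \<Rightarrow> (real \<Rightarrow> real ^ 'n) \<Rightarrow> (real \<Rightarrow> real ^ 'n) \<Rightarrow> (nat \<Rightarrow> ereal) \<Rightarrow> bool" where
  "etc_solution A1 A2 B P K \<tau> r \<alpha> \<beta> \<sigma> \<phi> x t \<longleftrightarrow>
     (let T = (SUP k. t k) in
        T > 0 \<and>
        (\<forall>s\<in>{-r..0}. x s = \<phi> s) \<and>
        continuous_on {s. -r \<le> s \<and> ereal s < T} x \<and>
        t 0 = 0 \<and>
        (\<forall>k. t (Suc k) = next_event P B K \<alpha> \<beta> \<sigma> r \<phi> x T (t k)) \<and>
        (\<forall>k s. t k \<le> ereal s \<and> ereal s < t (Suc k) \<longrightarrow>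
           (x has_vector_derivative
              (A1 *v x s + A2 *v x (s - \<tau> s) + B *v (K *v x (real_of_ereal (t k)))))
             (at s within {u. t k \<le> ereal u \<and> ereal u < t (Suc k)})))"

definition zeno :: "(nat \<Rightarrow> ereal) \<Rightarrow> bool" where
  "zeno t \<longleftrightarrow> (\<exists>a b :: real. infinite {k. ereal a \<le> t k \<and> t k \<le> ereal b})"

text \<open>
  \<open>sol \<phi> x t\<close> stands for: \<open>(x, t)\<close> is a trajectory with initial function \<open>\<phi>\<close>.  The
  requirement on the supremum of the event times says that it exists on all of \<open>[-r, \<infinity>)\<close>.
\<close>

definition globally_exp_stable ::
    "real \<Rightarrow> ((real \<Rightarrow> real ^ 'n) \<Rightarrow> (real \<Rightarrow> real ^ 'n) \<Rightarrow> (nat \<Rightarrow> ereal) \<Rightarrow> bool) \<Rightarrow> bool" where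
  "globally_exp_stable r sol \<longleftrightarrow>
     (\<exists>M > 0. \<exists>\<gamma> > 0. \<forall>\<phi> x t. continuous_on {-r..0} \<phi> \<and> sol \<phi> x t \<longrightarrow>
        (SUP k. t k) = \<infinity> \<and>
        (\<forall>s \<ge> 0. norm (x s) \<le> M * (SUP \<theta>\<in>{-r..0}. norm (\<phi> \<theta>)) * exp (- \<gamma> * s)))"

end

theory Submission
  imports Defs
begin

text \<open>
  Along a trajectory put \<open>V(s) = x(s)\<^sup>T P x(s)\<close>.  The substitution \<open>y = P x\<close> turns the matrix
  inequality into the dissipation inequality \<open>V' \<le> - (b + h) V(s) + b V(s - \<tau>(s)) +
  2 x\<^sup>T P B K \<epsilon>\<close> (\<open>lmi_dissipation\<close>), and as long as the trigger is silent the error term is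
  at most \<open>\<sigma> V + \<alpha> N exp (- \<beta> s)\<close>, where \<open>N\<close> is the supremum of \<open>V\<close> over the initial
  interval.  This is a scalar delay inequality of Halanay type with a decaying forcing term.  If
  \<open>\<gamma> \<le> \<beta>\<close> and \<open>b exp (\<gamma> r) + \<gamma> + \<alpha> \<le> b + h - \<sigma>\<close>, then every \<open>M exp (- \<gamma> s)\<close> with
  \<open>M > N\<close> is a strict supersolution, so \<open>V(s) \<le> N exp (- \<gamma> s)\<close> (\<open>halanay_inequality\<close>,
  \<open>V_decay\<close>).  Since \<open>h > \<alpha> + \<sigma>\<close>, some \<open>\<gamma> > 0\<close> is admissible, namely the smaller of \<open>\<beta>\<close>
  and the root \<open>\<lambda>\<close>.  The estimate holds on the whole interval of existence, be it finite or
  not.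

  Separation of the events follows from the decay (\<open>inter_event_gap\<close>).  Between two events
  \<open>e < u\<close> the state moves with a speed of order \<open>sqrt N exp (- \<gamma> e / 2)\<close>, so that
  \<open>x\<^sup>T P B K \<epsilon>\<close> is at most of order \<open>N exp (- \<gamma> (e + u) / 2) (u - e)\<close> at time \<open>u\<close>, whereas
  it has to reach \<open>\<alpha> N exp (- \<beta> u)\<close> there.  The factor \<open>N\<close> cancels, which makes the estimate
  independent of the initial function.  On a bounded interval the threshold stays away from
  zero, so the events cannot accumulate (\<open>T_infinite\<close>): this is the absence of Zeno behavior
  and, at the same time, existence for all times.  If \<open>\<beta> \<le> \<lambda>\<close>, then \<open>\<gamma> = \<beta>\<close> is admissible,
  both sides of the comparison decay at the same rate, and the lower bound for \<open>u - e\<close> is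
  uniform in time as well (\<open>inter_event_time_ge\<close>).

  The zero initial function needs a separate argument, because after the initial event there
  is no trigger to control the error.  There the control is zero, and the same comparison with
  \<open>N = 0\<close> and a negative rate shows that the trajectory vanishes.
\<close>

section \<open>Quadratic forms and the matrix inequality\<close>

lemma quad_form_zero [simp]: "quad_form P 0 = 0"
  by (simp add: quad_form_def)

lemma pos_def_quad_form_pos: "pos_def P \<Longrightarrow> v \<noteq> 0 \<Longrightarrow> quad_form P v > 0"
  by (simp add: pos_def_def quad_form_def)

lemma pos_def_quad_form_nonneg: "pos_def P \<Longrightarrow> quad_form P v \<ge> 0"
  by (cases "v = 0") (auto intro: less_imp_le pos_def_quad_form_pos)

lemma continuous_on_quad_form [continuous_intros]:
  "continuous_on S f \<Longrightarrow> continuous_on S (\<lambda>s. quad_form P (f s))"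
  unfolding quad_form_def
  by (intro continuous_on_inner bounded_linear.continuous_on[OF matrix_vector_mul_bounded_linear])

lemma pos_def_symmetric_inner:
  assumes "pos_def P"
  shows "v \<bullet> (P *v w) = w \<bullet> (P *v v)"
  using assms by (metis dot_lmul_matrix inner_commute matrix_vector_mul_linear pos_def_def transpose_matrix_vector)

text \<open>
  The constant is the minimum of the quadratic form on the unit sphere, attained by compactness;
  homogeneity does the rest.
\<close>

lemma pos_def_coercive:
  fixes P :: "real ^ 'n ^ 'n"
  assumes "pos_def P"
  obtains p where "p > 0" "\<And>v. p * (norm v)\<^sup>2 \<le> quad_form P v"
proof -
  have ne: "sphere (0 :: real ^ 'n) 1 \<noteq> {}"
    by simp
  obtain w where w: "w \<in> sphere 0 1" "\<And>v. v \<in> sphere 0 1 \<Longrightarrow> quad_form P w \<le> quad_form P v"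
    using continuous_attains_inf[OF compact_sphere ne, of "quad_form P"]
      continuous_on_quad_form[OF continuous_on_id, of "sphere 0 1" P] by auto
  have "quad_form P w * (norm v)\<^sup>2 \<le> quad_form P v" for v
  proof (cases "v = 0")
    case False
    have "quad_form P w \<le> quad_form P ((1 / norm v) *\<^sub>R v)"
      using False by (intro w) simp
    also have "\<dots> = quad_form P v / (norm v)\<^sup>2"
      by (simp add: quad_form_def matrix_vector_mult_scaleR power2_eq_square)
    finally show ?thesis
      using False by (simp add: field_simps)
  qed simp
  moreover have "quad_form P w > 0"
    using w(1) assms by (intro pos_def_quad_form_pos) auto
  ultimately show thesis
    using that by blast
qed

lemma quad_form_le_onorm: "quad_form P v \<le> onorm ((*v) P) * (norm v)\<^sup>2"
proof -
  have "quad_form P v \<le> norm v * norm (P *v v)"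
    unfolding quad_form_def by (rule norm_cauchy_schwarz)
  also have "\<dots> \<le> norm v * (onorm ((*v) P) * norm v)"
    by (intro mult_left_mono onorm matrix_vector_mul_bounded_linear) simp
  finally show ?thesis
    by (simp add: power2_eq_square mult_ac)
qed

lemma pos_def_matrix_inv:
  fixes Q :: "real ^ 'n ^ 'n"
  assumes "pos_def Q"
  shows "Q ** matrix_inv Q = mat 1" "matrix_inv Q ** Q = mat 1" "pos_def (matrix_inv Q)"
proof -
  let ?P = "matrix_inv Q"
  have "v = 0" if "Q *v v = 0" for v
    using assms that by (force simp: pos_def_def)
  then have "invertible Q"
    by (metis invertible_left_inverse matrix_left_invertible_ker)
  then show inv: "Q ** ?P = mat 1" "?P ** Q = mat 1"
    using someI_ex[OF \<open>invertible Q\<close>[unfolded invertible_def]] by (auto simp: matrix_inv_def)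
  have sym: "transpose Q = Q"
    using assms by (simp add: pos_def_def)
  have "transpose ?P ** Q = mat 1"
    by (metis inv(1) sym matrix_transpose_mul transpose_mat)
  then have "transpose ?P = ?P"
    by (metis inv(1) matrix_mul_assoc matrix_mul_lid matrix_mul_rid)
  moreover have "v \<bullet> (?P *v v) > 0" if "v \<noteq> 0" for v
  proof -
    have v: "Q *v (?P *v v) = v"
      by (simp add: matrix_vector_mul_assoc inv)
    then have "?P *v v \<noteq> 0"
      using that by auto
    then have "(?P *v v) \<bullet> (Q *v (?P *v v)) > 0"
      using assms by (simp add: pos_def_def)
    then show ?thesis
      by (simp add: v inner_commute)
  qed
  ultimately show "pos_def ?P"
    by (simp add: pos_def_def)
qed

lemma block_matrix_quad_form:
  fixes y z :: "real ^ 'n"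
  defines "u \<equiv> \<chi> i. case i of Inl p \<Rightarrow> y $ p | Inr p \<Rightarrow> z $ p"
  shows "u \<bullet> (block_matrix M11 M12 M21 M22 *v u)
    = y \<bullet> (M11 *v y) + y \<bullet> (M12 *v z) + z \<bullet> (M21 *v y) + z \<bullet> (M22 *v z)"
proof -
  have split: "(\<Sum>i\<in>UNIV. f i) = (\<Sum>p\<in>UNIV. f (Inl p)) + (\<Sum>p\<in>UNIV. f (Inr p))"
    for f :: "'n + 'n \<Rightarrow> real"
    by (subst UNIV_Plus_UNIV[symmetric], subst sum.Plus) (auto simp: o_def)
  show ?thesis
    by (simp add: inner_vec_def matrix_vector_mult_def block_matrix_def u_def split
        sum.distrib algebra_simps)
qed

lemma neg_def_quad_form_nonpos: "neg_def M \<Longrightarrow> v \<bullet> (M *v v) \<le> 0"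
  by (cases "v = 0") (auto simp: neg_def_def intro: less_imp_le)

text \<open>
  The block matrix is evaluated at \<open>(y, z) = (P v, P w)\<close>, that is, the inequality is congruent
  under \<open>diag (P, P)\<close> to one for the form in \<open>(v, w)\<close>.  The left-hand side is the derivative of
  \<open>V\<close> at the state \<open>v\<close> with delayed state \<open>w\<close> under continuous feedback \<open>u = K x\<close>, so this is
  the dissipation of the loop without sampling error.
\<close>

lemma lmi_dissipation:
  fixes A1 A2 Q P :: "real ^ 'n ^ 'n" and B :: "real ^ 'm ^ 'n" and R K :: "real ^ 'n ^ 'm"
  assumes Q: "pos_def Q"
    and lmi: "neg_def (block_matrix
           (Q ** transpose A1 + A1 ** Q + transpose R ** transpose B + B ** R + (b + h) *\<^sub>R Q)
           (A2 ** Q)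
           (Q ** transpose A2)
           (- (b *\<^sub>R Q)))"
    and P: "P = matrix_inv Q" and K: "K = R ** P"
  shows "2 * (v \<bullet> (P *v (A1 *v v + A2 *v w + B *v (K *v v))))
    \<le> - (b + h) * quad_form P v + b * quad_form P w"
proof -
  define y z where "y = P *v v" and "z = P *v w"
  have PQ: "P ** Q = mat 1" "Q ** P = mat 1" and "pos_def P"
    using pos_def_matrix_inv[OF Q] P by auto
  have v: "v = Q *v y" and w: "w = Q *v z"
    by (simp_all add: y_def z_def matrix_vector_mul_assoc PQ)
  have Kv: "K *v v = R *v y"
    by (simp add: K y_def matrix_vector_mul_assoc)
  have Qt: "transpose Q = Q"
    using Q by (simp add: pos_def_def)
  have adj: "a \<bullet> (transpose M *v c) = c \<bullet> (M *v a)" for M :: "real^'i^'j" and a c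
    by (metis dot_lmul_matrix inner_commute transpose_matrix_vector)
  have Qsym: "a \<bullet> (Q *v c) = c \<bullet> (Q *v a)" for a c
    using adj[of a Q c] Qt by simp
  have q: "quad_form P v = y \<bullet> (Q *v y)" "quad_form P w = z \<bullet> (Q *v z)"
    by (simp_all add: quad_form_def flip: y_def z_def) (simp_all add: v w inner_commute)
  have lhs: "v \<bullet> (P *v g) = y \<bullet> g" for g
    using pos_def_symmetric_inner[OF \<open>pos_def P\<close>, of v g] by (simp add: y_def inner_commute)
  have t1: "y \<bullet> ((Q ** transpose A1) *v y) = y \<bullet> (A1 *v v)"
    by (metis Qsym adj matrix_vector_mul_assoc v inner_commute)
  have t2: "y \<bullet> ((transpose R ** transpose B) *v y) = y \<bullet> (B *v (R *v y))"
    by (metis adj matrix_vector_mul_assoc inner_commute)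
  have t3: "z \<bullet> ((Q ** transpose A2) *v y) = y \<bullet> (A2 *v w)"
    by (metis Qsym adj matrix_vector_mul_assoc w inner_commute)
  have neg: "- (b *\<^sub>R Q) *v z = - (b *\<^sub>R (Q *v z))"
    by (metis scaleR_minus_left scaleR_matrix_vector_assoc)
  show ?thesis
    using neg_def_quad_form_nonpos[OF lmi,
        of "\<chi> i. case i of Inl p \<Rightarrow> y $ p | Inr p \<Rightarrow> z $ p"]
    unfolding block_matrix_quad_form lhs q Kv
    by (simp add: matrix_vector_mult_add_rdistrib inner_add_right t1 t2 t3 neg
        del: transpose_matrix_vector flip: scaleR_matrix_vector_assoc)
      (simp add: v w matrix_vector_mul_assoc algebra_simps)
qed

section \<open>Comparison for scalar delay inequalities\<close>

text \<open>
  Only right derivatives are available, since the vector field jumps at the events.  They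
  exclude an upcrossing of zero if one looks at the infimum of the set where \<open>U > 0\<close> rather than
  at the first zero: there \<open>U\<close> vanishes, but a negative right derivative keeps \<open>U\<close> below zero for
  some further time.
\<close>

lemma nonpos_if_decreasing_at_zeros:
  fixes U :: "real \<Rightarrow> real"
  assumes cont: "continuous_on {a..c} U" and init: "U a \<le> 0"
    and step: "\<And>s. s \<in> {a..<c} \<Longrightarrow> (\<And>u. u \<in> {a..s} \<Longrightarrow> U u \<le> 0) \<Longrightarrow> U s = 0 \<Longrightarrow>
      \<exists>D<0. (U has_real_derivative D) (at_right s)"
    and "s \<in> {a..c}"
  shows "U s \<le> 0"
proof (rule ccontr)
  assume "\<not> U s \<le> 0"
  define Z where "Z = {u \<in> {a..c}. U u > 0}"
  define z where "z = Inf Z"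
  have "s \<in> Z"
    using \<open>\<not> U s \<le> 0\<close> \<open>s \<in> {a..c}\<close> by (simp add: Z_def)
  have bdd: "bdd_below Z"
    by (auto simp: Z_def intro: bdd_belowI[of _ a])
  have z: "a \<le> z" "z \<le> s"
    using \<open>s \<in> Z\<close> bdd by (auto simp: z_def Z_def intro!: cInf_greatest cInf_lower)
  have before: "U u \<le> 0" if "a \<le> u" "u < z" for u
    using that bdd z \<open>s \<in> {a..c}\<close> cInf_lower[of u Z] by (force simp: z_def Z_def)
  have "U z \<ge> 0"
  proof -
    have "z \<in> closure Z"
      unfolding z_def using \<open>s \<in> Z\<close> bdd by (intro closure_contains_Inf) auto
    moreover have "closed {u \<in> {a..c}. 0 \<le> U u}"
      using continuous_on_closed_Collect_le[OF continuous_on_const cont, of 0] by simp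
    then have "closure Z \<subseteq> {u \<in> {a..c}. 0 \<le> U u}"
      by (intro closure_minimal) (auto simp: Z_def)
    ultimately show ?thesis
      by auto
  qed
  moreover have "U z \<le> 0"
  proof (cases "z = a")
    case False
    have "continuous_on {a..z} U"
      using cont z \<open>s \<in> {a..c}\<close> by (auto elim!: continuous_on_subset)
    then have "closed {u \<in> {a..z}. U u \<le> 0}"
      using continuous_on_closed_Collect_le[OF _ continuous_on_const, of "{a..z}" U 0] by simp
    then have "closure {a..<z} \<subseteq> {u \<in> {a..z}. U u \<le> 0}"
      using before by (intro closure_minimal) auto
    then show ?thesis
      using False z by auto
  qed (use init in simp)
  ultimately have "U z = 0"
    by simp
  have "z < s"
    using z \<open>U z = 0\<close> \<open>\<not> U s \<le> 0\<close> by (cases "z = s") auto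
  have "\<exists>D<0. (U has_real_derivative D) (at_right z)"
    using \<open>z < s\<close> z \<open>s \<in> {a..c}\<close> \<open>U z = 0\<close> before
    by (intro step) (auto simp: le_less)
  then obtain D where D: "D < 0" "(U has_real_derivative D) (at_right z)"
    by blast
  obtain d where d: "d > 0" "\<And>h. 0 < h \<Longrightarrow> h < d \<Longrightarrow> U (z + h) < 0"
    using has_real_derivative_neg_dec_right[OF D(2,1)] \<open>U z = 0\<close> by auto
  obtain u where u: "u \<in> Z" "u < z + d"
    using cInf_lessD[of Z "z + d"] \<open>s \<in> Z\<close> \<open>d > 0\<close> by (auto simp: z_def)
  have "z \<le> u"
    using u bdd by (auto simp: z_def intro: cInf_lower)
  then show False
    using d(2)[of "u - z"] u \<open>U z = 0\<close> by (cases "u = z") (auto simp: Z_def)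
qed

text \<open>
  The comparison functions are \<open>M exp (- \<gamma> s)\<close> with \<open>M > N\<close>.  The gap between \<open>M\<close> and \<open>N\<close> makes
  the forcing term strictly smaller than \<open>\<alpha>\<close> times the comparison function, and this strictness
  keeps \<open>V\<close> from rising above it; then \<open>M\<close> tends to \<open>N\<close>.  The rate condition is stated with
  \<open>exp (\<gamma> * \<tau> s)\<close> instead of \<open>exp (\<gamma> * r)\<close> and \<open>\<gamma>\<close> may be negative: with \<open>N = 0\<close> a negative
  rate turns the lemma into a uniqueness statement of Gronwall type.
\<close>

lemma halanay_inequality:
  fixes V \<tau> :: "real \<Rightarrow> real"
  assumes cont: "continuous_on {0..S} V" and "0 \<le> S"
    and init: "\<And>s. s \<in> {-r..0} \<Longrightarrow> V s \<le> N * exp (- \<gamma> * s)"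
    and "N \<ge> 0" "r \<ge> 0" "b \<ge> 0" "\<alpha> > 0"
    and delay: "\<And>s. s \<in> {0..<S} \<Longrightarrow> \<tau> s \<in> {0..r}"
    and deriv: "\<And>s. s \<in> {0..<S} \<Longrightarrow> \<exists>D. (V has_real_derivative D) (at_right s) \<and>
        D \<le> - a * V s + b * V (s - \<tau> s) + \<alpha> * N * exp (- \<gamma> * s)"
    and rate: "\<And>s. s \<in> {0..<S} \<Longrightarrow> b * exp (\<gamma> * \<tau> s) + \<gamma> + \<alpha> \<le> a"
  shows "V S \<le> N * exp (- \<gamma> * S)"
proof -
  have strict: "V S \<le> M * exp (- \<gamma> * S)" if "M > N" for M
  proof -
    let ?W = "\<lambda>s. M * exp (- \<gamma> * s)"
    have init': "V s \<le> ?W s" if "s \<in> {-r..0}" for s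
      using \<open>M > N\<close> by (intro order_trans[OF init[OF that]] mult_right_mono) auto
    have "V S - ?W S \<le> 0"
    proof (rule nonpos_if_decreasing_at_zeros[of 0 S "\<lambda>s. V s - ?W s"])
      fix s assume s: "s \<in> {0..<S}" and below: "\<And>u. u \<in> {0..s} \<Longrightarrow> V u - ?W u \<le> 0"
        and eq: "V s - ?W s = 0"
      obtain D where D: "(V has_real_derivative D) (at_right s)"
        "D \<le> - a * V s + b * V (s - \<tau> s) + \<alpha> * N * exp (- \<gamma> * s)"
        using deriv[OF s] by blast
      have "V (s - \<tau> s) \<le> ?W (s - \<tau> s)"
        using below[of "s - \<tau> s"] init'[of "s - \<tau> s"] delay[OF s] s by (cases "\<tau> s \<le> s") auto
      also have "\<dots> = exp (\<gamma> * \<tau> s) * ?W s"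
        by (simp add: right_diff_distrib exp_add[symmetric])
      finally have "b * V (s - \<tau> s) \<le> b * exp (\<gamma> * \<tau> s) * ?W s"
        using \<open>b \<ge> 0\<close> by (metis mult.assoc mult_left_mono)
      moreover have "\<alpha> * N * exp (- \<gamma> * s) < \<alpha> * ?W s"
        using \<open>M > N\<close> \<open>\<alpha> > 0\<close> by simp
      ultimately have D_less: "D < (b * exp (\<gamma> * \<tau> s) + \<alpha> - a) * ?W s"
        using D(2) eq by (simp add: algebra_simps)
      show "\<exists>D<0. ((\<lambda>s. V s - ?W s) has_real_derivative D) (at_right s)"
      proof (intro exI conjI)
        have "((\<lambda>s. V s - ?W s) has_real_derivative D - M * (exp (- \<gamma> * s) * (- \<gamma>))) (at_right s)"
          by (auto intro!: derivative_eq_intros D(1))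
        then show "((\<lambda>s. V s - ?W s) has_real_derivative D + \<gamma> * ?W s) (at_right s)"
          by (simp add: algebra_simps)
        have "(b * exp (\<gamma> * \<tau> s) + \<alpha> - a) * ?W s \<le> - \<gamma> * ?W s"
          using rate[OF s] \<open>N \<ge> 0\<close> \<open>M > N\<close> by (intro mult_right_mono) auto
        then show "D + \<gamma> * ?W s < 0"
          using D_less by simp
      qed
    next
      show "continuous_on {0..S} (\<lambda>s. V s - ?W s)"
        by (intro continuous_intros cont)
    next
      show "V 0 - ?W 0 \<le> 0"
        using init'[of 0] \<open>r \<ge> 0\<close> by simp
    qed (use \<open>0 \<le> S\<close> in auto)
    then show ?thesis
      by simp
  qed
  show ?thesis
  proof (rule field_le_epsilon)
    fix e :: real assume "e > 0"
    show "V S \<le> N * exp (- \<gamma> * S) + e"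
      using strict[of "N + e / exp (- \<gamma> * S)"] \<open>e > 0\<close> by (simp add: distrib_right)
  qed
qed

section \<open>Trajectories of the event-triggered loop\<close>

locale etc_trajectory =
  fixes A1 A2 P :: "real ^ 'n ^ 'n" and B :: "real ^ 'm ^ 'n" and K :: "real ^ 'n ^ 'm"
    and \<tau> :: "real \<Rightarrow> real" and r \<alpha> \<beta> \<sigma> :: real
    and \<phi> x :: "real \<Rightarrow> real ^ 'n" and t :: "nat \<Rightarrow> ereal"
  assumes r_nonneg: "r \<ge> 0"
    and delay: "\<And>s. s \<ge> 0 \<Longrightarrow> \<tau> s \<in> {0..r}"
    and P: "pos_def P"
    and \<alpha>_pos: "\<alpha> > 0" and \<sigma>_nonneg: "\<sigma> \<ge> 0"
    and \<phi>_continuous: "continuous_on {-r..0} \<phi>"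
    and solution: "etc_solution A1 A2 B P K \<tau> r \<alpha> \<beta> \<sigma> \<phi> x t"
begin

definition T where "T = (SUP k. t k)"
definition N where "N = (SUP \<theta>\<in>{-r..0}. quad_form P (\<phi> \<theta>))"
definition V where "V s = quad_form P (x s)"
definition sample where "sample k = x (real_of_ereal (t k))"

lemma initial: "s \<in> {-r..0} \<Longrightarrow> x s = \<phi> s"
  and x_continuous: "continuous_on {s. -r \<le> s \<and> ereal s < T} x"
  and t_0: "t 0 = 0"
  and t_Suc: "t (Suc k) = next_event P B K \<alpha> \<beta> \<sigma> r \<phi> x T (t k)"
  and T_pos: "T > 0"
  using solution unfolding etc_solution_def Let_def T_def by blast+

lemma x_derivative:
  assumes "t k \<le> ereal s" "ereal s < t (Suc k)"
  shows "(x has_vector_derivative (A1 *v x s + A2 *v x (s - \<tau> s) + B *v (K *v sample k)))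
    (at s within {u. t k \<le> ereal u \<and> ereal u < t (Suc k)})"
  using solution assms unfolding etc_solution_def Let_def sample_def by blast

lemma t_le_Suc: "t k \<le> t (Suc k)"
  unfolding t_Suc next_event_def by (auto intro!: Inf_greatest)

lemma incseq_t: "incseq t"
  by (rule incseq_SucI) (rule t_le_Suc)

lemma t_nonneg: "0 \<le> t k"
  using incseqD[OF incseq_t, of 0 k] by (simp add: t_0)

lemma t_le_T: "t k \<le> T"
  unfolding T_def by (rule SUP_upper) simp

text \<open>
  If an infimum in the triggering rule were equal to the current event time, all later event
  times would coincide with it and would also be the end of the interval of existence; but then
  the set of candidates for the next event is empty and its infimum is \<open>\<infinity>\<close>.
\<close>

lemma t_less_Suc:
  assumes "t k \<noteq> \<infinity>"
  shows "t k < t (Suc k)"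
proof (rule ccontr)
  assume "\<not> t k < t (Suc k)"
  then have eq: "t (Suc k) = t k"
    using t_le_Suc[of k] by simp
  have "t (k + j) = t k" for j
  proof (induction j)
    case (Suc j)
    then show ?case
      using eq t_Suc[of k] t_Suc[of "k + j"] by simp
  qed simp
  then have "t i \<le> t k" for i
    by (metis incseqD[OF incseq_t] le_add2)
  then have "T = t k"
    by (intro antisym t_le_T) (auto simp: T_def intro: SUP_least)
  then have empty: "{ereal s | s. t k < ereal s \<and> ereal s < T \<and> C s} = {}" for C
    by auto
  have "t (Suc k) = \<infinity>"
    unfolding t_Suc next_event_def empty by (simp add: top_ereal_def)
  then show False
    using eq assms by simp
qed

lemma t_less_T: "t k \<noteq> \<infinity> \<Longrightarrow> t k < T"
  using t_less_Suc t_le_T by (meson less_le_trans)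

lemma sampling_interval:
  assumes "0 \<le> s" "ereal s < T"
  obtains k where "t k \<le> ereal s" "ereal s < t (Suc k)"
proof -
  obtain i where i: "ereal s < t i"
    using assms(2) unfolding T_def less_SUP_iff by blast
  define j where "j = (LEAST i. ereal s < t i)"
  have j: "ereal s < t j" "\<And>i. i < j \<Longrightarrow> \<not> ereal s < t i"
    unfolding j_def using i by (auto intro: LeastI dest: not_less_Least)
  obtain k where "j = Suc k"
    using j(1) assms(1) by (cases j) (auto simp: t_0 zero_ereal_def)
  then show thesis
    using that[of k] j by (auto simp: not_less)
qed

lemma V_nonneg: "V s \<ge> 0"
  using pos_def_quad_form_nonneg[OF P] by (simp add: V_def)

lemma V_continuous: "continuous_on {s. -r \<le> s \<and> ereal s < T} V"
  unfolding V_def by (intro continuous_intros x_continuous)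

lemma quad_form_initial_le: "\<theta> \<in> {-r..0} \<Longrightarrow> quad_form P (\<phi> \<theta>) \<le> N"
  unfolding N_def using \<phi>_continuous
  by (intro cSUP_upper bounded_imp_bdd_above compact_imp_bounded compact_continuous_image
      continuous_intros) auto

lemma V_initial_le: "s \<in> {-r..0} \<Longrightarrow> V s \<le> N"
  using quad_form_initial_le by (simp add: V_def initial)

lemma N_nonneg: "N \<ge> 0"
  using V_initial_le[of 0] V_nonneg[of 0] r_nonneg by simp

lemma N_pos: "\<theta> \<in> {-r..0} \<Longrightarrow> \<phi> \<theta> \<noteq> 0 \<Longrightarrow> N > 0"
  using quad_form_initial_le pos_def_quad_form_pos[OF P] by (meson less_le_trans)

text \<open>
  The initial function vanishes exactly if \<open>N = 0\<close>; this lemma and \<open>N_pos\<close> reduce the case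
  distinction in the triggering rule to the sign of \<open>N\<close>.
\<close>

lemma zero_initial:
  assumes "\<forall>\<theta>\<in>{-r..0}. \<phi> \<theta> = 0"
  shows "t (Suc k) = \<infinity>" "T = \<infinity>" "N = 0"
proof -
  show inf: "t (Suc k) = \<infinity>" for k
    unfolding t_Suc next_event_def using assms by simp
  show "T = \<infinity>"
    using t_le_T[of 1] inf[of 0] by simp
  show "N = 0"
    using assms r_nonneg by (simp add: N_def)
qed

text \<open>
  At the event itself the error is zero and the threshold is positive because \<open>N > 0\<close>; later
  instants that meet the condition would be candidates for the next event.
\<close>

lemma not_triggered:
  assumes "N > 0" "t k \<le> ereal s" "ereal s < t (Suc k)"
  shows "trigger_fun P B K \<sigma> (x s) (sample k - x s) < \<alpha> * N * exp (- \<beta> * s)"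
proof (cases "t k = ereal s")
  case True
  have "0 < \<alpha> * N * exp (- \<beta> * s)"
    using \<open>N > 0\<close> \<alpha>_pos by simp
  moreover have "\<sigma> * V s \<ge> 0"
    using \<sigma>_nonneg V_nonneg by simp
  ultimately show ?thesis
    using True by (simp add: trigger_fun_def sample_def V_def)
next
  case False
  then have "t k < ereal s"
    using assms by simp
  moreover have "\<not> (\<forall>\<theta>\<in>{-r..0}. \<phi> \<theta> = 0)"
    using \<open>N > 0\<close> zero_initial by auto
  moreover have "ereal s < T"
    using assms(3) t_le_T by (rule less_le_trans)
  ultimately have "t (Suc k) \<le> ereal s"
    if "trigger_fun P B K \<sigma> (x s) (sample k - x s) \<ge> \<alpha> * N * exp (- \<beta> * s)"
    using that unfolding t_Suc next_event_def trigger_threshold_def N_def sample_def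
    by (auto intro: Inf_lower)
  then show ?thesis
    using assms(3) by (meson not_le)
qed

text \<open>
  The infimum in the triggering rule is attained: the next event lies strictly inside the
  interval of existence, where the triggering condition is closed by continuity of the
  trajectory.
\<close>

lemma triggered:
  assumes "t (Suc k) = ereal u"
  shows "trigger_fun P B K \<sigma> (x u) (sample k - x u) \<ge> \<alpha> * N * exp (- \<beta> * u)"
proof (rule ccontr)
  define f where "f s = trigger_fun P B K \<sigma> (x s) (sample k - x s) - \<alpha> * N * exp (- \<beta> * s)" for s
  define S where "S = {ereal s | s. t k < ereal s \<and> ereal s < T \<and> f s \<ge> 0}"
  assume "\<not> ?thesis"
  then have "f u < 0"
    by (simp add: f_def)
  have tS: "t (Suc k) = Inf S"
    using assms zero_initial(1)[of k] unfolding t_Suc next_event_def S_def f_def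
    by (auto simp: trigger_threshold_def N_def sample_def split: if_splits)
  \<comment> \<open>Continuity at \<open>u\<close> needs a two-sided neighbourhood in the interval of existence.\<close>
  have "ereal u < T"
    using t_less_T[of "Suc k"] assms by simp
  have "t k < ereal u"
    using t_less_Suc[of k] t_le_Suc[of k] assms by (cases "t k = \<infinity>") auto
  then have "0 < u"
    using order_le_less_trans[OF t_nonneg] by force
  obtain w where w: "u < w" "ereal w < T"
    using ereal_dense2[OF \<open>ereal u < T\<close>] by auto
  have "continuous_on {-r<..<w} f"
  proof -
    have "continuous_on {-r<..<w} x"
      using w by (intro continuous_on_subset[OF x_continuous]) (auto intro: less_trans[of _ "ereal w"])
    then show ?thesis
      unfolding f_def trigger_fun_def
      by (intro continuous_intros bounded_linear.continuous_on[OF matrix_vector_mul_bounded_linear])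
  qed
  then have "isCont f u"
    using \<open>0 < u\<close> r_nonneg w by (simp add: continuous_on_eq_continuous_at)
  then have "\<forall>\<^sub>F s in nhds u. f s < 0"
    using \<open>f u < 0\<close> order_tendstoD(2)[of f "f u" "nhds u" 0]
    by (simp add: isCont_def tendsto_at_iff_tendsto_nhds)
  then obtain d where d: "d > 0" "\<And>s. dist s u < d \<Longrightarrow> f s < 0"
    unfolding eventually_nhds_metric by blast
  have "ereal (u + d) \<le> Inf S"
  proof (rule Inf_greatest)
    fix e assume "e \<in> S"
    then obtain s where s: "e = ereal s" "f s \<ge> 0" "t (Suc k) \<le> e"
      using tS by (auto simp: S_def intro: Inf_lower)
    then show "ereal (u + d) \<le> e"
      using d(2)[of s] assms by (force simp: dist_real_def)
  qed
  then show False
    using \<open>d > 0\<close> unfolding tS[symmetric] assms by simp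
qed

lemma V_derivative:
  assumes "t k \<le> ereal s" "ereal s < t (Suc k)"
  shows "(V has_real_derivative
    2 * (x s \<bullet> (P *v (A1 *v x s + A2 *v x (s - \<tau> s) + B *v (K *v sample k))))) (at_right s)"
    (is "(V has_real_derivative 2 * (_ \<bullet> (P *v ?g))) _")
proof -
  obtain w where w: "s < w" "ereal w < t (Suc k)"
    using ereal_dense2[OF assms(2)] by auto
  have sub: "{s<..<w} \<subseteq> {u. t k \<le> ereal u \<and> ereal u < t (Suc k)}"
    using assms(1) w(2) by (auto intro: order_trans[of _ "ereal s"] less_trans[of _ "ereal w"])
  have "at s within {s<..<w} = at_right s"
    by (rule at_within_nhd[of s "{..<w}"]) (use w in auto)
  then have "(x has_vector_derivative ?g) (at_right s)"
    using has_vector_derivative_within_subset[OF x_derivative[OF assms] sub] by simp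
  then have "(V has_vector_derivative x s \<bullet> (P *v ?g) + ?g \<bullet> (P *v x s)) (at_right s)"
    unfolding V_def quad_form_def
    by (intro bounded_bilinear.has_vector_derivative[OF bounded_bilinear_inner]
        bounded_linear.has_vector_derivative[OF matrix_vector_mul_bounded_linear])
  moreover have "?g \<bullet> (P *v x s) = x s \<bullet> (P *v ?g)"
    by (rule pos_def_symmetric_inner[OF P])
  ultimately show ?thesis
    by (simp add: has_real_derivative_iff_has_vector_derivative)
qed

text \<open>
  Writing the sampled state as \<open>x + \<epsilon>\<close> splits off the continuous feedback, to which the
  dissipation inequality applies.
\<close>

lemma V_derivative_closed_loop:
  assumes "t k \<le> ereal s" "ereal s < t (Suc k)"
    and diss: "\<And>v w. 2 * (v \<bullet> (P *v (A1 *v v + A2 *v w + B *v (K *v v))))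
      \<le> - (b + h) * quad_form P v + b * quad_form P w"
  shows "\<exists>D. (V has_real_derivative D) (at_right s) \<and>
    D \<le> - (b + h) * V s + b * V (s - \<tau> s) + 2 * (x s \<bullet> ((P ** B ** K) *v (sample k - x s)))"
proof (intro exI conjI)
  have "x s \<bullet> (P *v (A1 *v x s + A2 *v x (s - \<tau> s) + B *v (K *v sample k)))
    = x s \<bullet> (P *v (A1 *v x s + A2 *v x (s - \<tau> s) + B *v (K *v x s)))
      + x s \<bullet> ((P ** B ** K) *v (sample k - x s))"
    by (simp add: matrix_vector_mul_assoc[symmetric] matrix_vector_right_distrib
        matrix_vector_mult_diff_distrib inner_add_right inner_diff_right)
  then show "2 * (x s \<bullet> (P *v (A1 *v x s + A2 *v x (s - \<tau> s) + B *v (K *v sample k))))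
    \<le> - (b + h) * V s + b * V (s - \<tau> s) + 2 * (x s \<bullet> ((P ** B ** K) *v (sample k - x s)))"
    using diss[of "x s" "x (s - \<tau> s)"] by (simp add: V_def)
qed (rule V_derivative[OF assms(1,2)])

text \<open>
  For a nonzero initial function the silent trigger bounds the error term.  For the zero initial
  function there is no such bound, but the sample is \<open>x 0 = 0\<close>, hence \<open>\<epsilon> = - x\<close> and the
  error term is a multiple of \<open>V\<close>; a sufficiently negative rate absorbs it.
\<close>

lemma V_decay:
  assumes diss: "\<And>v w. 2 * (v \<bullet> (P *v (A1 *v v + A2 *v w + B *v (K *v v))))
      \<le> - (b + h) * quad_form P v + b * quad_form P w"
    and "b > 0" "0 \<le> \<gamma>" "\<gamma> \<le> \<beta>" and rate: "b * exp (\<gamma> * r) + \<gamma> + \<alpha> \<le> b + h - \<sigma>"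
    and "-r \<le> s" "ereal s < T"
  shows "V s \<le> N * exp (- \<gamma> * s)"
proof (cases "s \<le> 0")
  case True
  have "N * 1 \<le> N * exp (- \<gamma> * s)"
    using N_nonneg True \<open>0 \<le> \<gamma>\<close> by (intro mult_left_mono) (auto simp: mult_nonneg_nonpos)
  then show ?thesis
    using V_initial_le[of s] True \<open>-r \<le> s\<close> by simp
next
  case False
  have cont: "continuous_on {0..s} V"
    using r_nonneg \<open>ereal s < T\<close>
    by (intro continuous_on_subset[OF V_continuous]) (auto intro: le_less_trans[of _ "ereal s"])
  have located: "\<exists>k. t k \<le> ereal u \<and> ereal u < t (Suc k)" if "u \<in> {0..<s}" for u
    using sampling_interval[of u] that \<open>ereal s < T\<close>
    by (metis atLeastLessThan_iff ereal_less_le less_ereal.simps(1) less_trans)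
  have init: "V u \<le> N * exp (- \<delta> * u)" if "u \<in> {-r..0}" "0 \<le> \<delta> \<or> N = 0" for u \<delta>
  proof -
    have "N * 1 \<le> N * exp (- \<delta> * u)"
      using N_nonneg that by (cases "N = 0") (auto intro!: mult_left_mono simp: mult_nonneg_nonpos)
    then show ?thesis
      using V_initial_le[of u] that by simp
  qed
  show ?thesis
  proof (cases "\<forall>\<theta>\<in>{-r..0}. \<phi> \<theta> = 0")
    case False
    then have "N > 0"
      using N_pos by blast
    show ?thesis
    proof (rule halanay_inequality[OF cont, where r = r and b = b and \<tau> = \<tau>
          and a = "b + h - \<sigma>" and \<alpha> = \<alpha>])
      fix u assume u: "u \<in> {0..<s}"
      obtain k where k: "t k \<le> ereal u" "ereal u < t (Suc k)"
        using located[OF u] by blast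
      obtain D where D: "(V has_real_derivative D) (at_right u)"
        "D \<le> - (b + h) * V u + b * V (u - \<tau> u) + 2 * (x u \<bullet> ((P ** B ** K) *v (sample k - x u)))"
        using V_derivative_closed_loop[OF k diss] by blast
      have "2 * (x u \<bullet> ((P ** B ** K) *v (sample k - x u))) < \<sigma> * V u + \<alpha> * N * exp (- \<beta> * u)"
        using not_triggered[OF \<open>N > 0\<close> k] by (simp add: trigger_fun_def V_def)
      also have "\<alpha> * N * exp (- \<beta> * u) \<le> \<alpha> * N * exp (- \<gamma> * u)"
        using \<open>N > 0\<close> \<alpha>_pos \<open>\<gamma> \<le> \<beta>\<close> u by (intro mult_left_mono) (auto intro: mult_right_mono)
      finally show "\<exists>D. (V has_real_derivative D) (at_right u) \<and>
          D \<le> - (b + h - \<sigma>) * V u + b * V (u - \<tau> u) + \<alpha> * N * exp (- \<gamma> * u)"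
        using D by (intro exI[of _ D]) (auto simp: algebra_simps)
      have "\<gamma> * \<tau> u \<le> \<gamma> * r"
        using delay[of u] u \<open>0 \<le> \<gamma>\<close> by (intro mult_left_mono) auto
      then have "b * exp (\<gamma> * \<tau> u) \<le> b * exp (\<gamma> * r)"
        using \<open>b > 0\<close> by simp
      then show "b * exp (\<gamma> * \<tau> u) + \<gamma> + \<alpha> \<le> b + h - \<sigma>"
        using rate by simp
    qed (use init \<open>0 \<le> \<gamma>\<close> \<open>\<not> s \<le> 0\<close> N_nonneg r_nonneg \<open>b > 0\<close> \<alpha>_pos delay in auto)
  next
    case True
    note zero = zero_initial[OF True]
    obtain p where p: "p > 0" "\<And>v. p * (norm v)\<^sup>2 \<le> quad_form P v"
      using pos_def_coercive[OF P] by blast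
    \<comment> \<open>\<open>c\<close> bounds the error term relative to \<open>V\<close>, and \<open>- L\<close> is a rate that satisfies
      the hypothesis of the comparison lemma with \<open>b + h - c\<close> in the role of \<open>a\<close>.\<close>
    define c where "c = 2 * onorm ((*v) (P ** B ** K)) / p"
    define L where "L = max 0 (1 + c - h)"
    have c: "2 * (v \<bullet> ((P ** B ** K) *v (- v))) \<le> c * quad_form P v" for v
    proof -
      have "v \<bullet> ((P ** B ** K) *v (- v)) \<le> norm v * (onorm ((*v) (P ** B ** K)) * norm (- v))"
        by (intro order_trans[OF norm_cauchy_schwarz] mult_left_mono onorm
            matrix_vector_mul_bounded_linear) simp
      then have "2 * (v \<bullet> ((P ** B ** K) *v (- v))) \<le> c * (p * (norm v)\<^sup>2)"
        using \<open>p > 0\<close> by (simp add: c_def power2_eq_square mult_ac)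
      also have "\<dots> \<le> c * quad_form P v"
        using p by (intro mult_left_mono) (auto simp: c_def onorm_pos_le matrix_vector_mul_bounded_linear)
      finally show ?thesis .
    qed
    \<comment> \<open>Since \<open>N = 0\<close> there is no forcing term, and its coefficient can be any positive number.\<close>
    have "V s \<le> 0 * exp (- (- L) * s)"
    proof (rule halanay_inequality[OF cont, where r = r and b = b and \<tau> = \<tau>
          and a = "b + h - c" and \<alpha> = 1])
      fix u assume u: "u \<in> {0..<s}"
      obtain k where k: "t k \<le> ereal u" "ereal u < t (Suc k)"
        using located[OF u] by blast
      have "k = 0"
        using k(1) zero(1) by (cases k) auto
      then have "sample k = 0"
        using True r_nonneg by (simp add: sample_def t_0 initial)
      then show "\<exists>D. (V has_real_derivative D) (at_right u) \<and>
          D \<le> - (b + h - c) * V u + b * V (u - \<tau> u) + 1 * 0 * exp (- (- L) * u)"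
        using V_derivative_closed_loop[OF k diss] c[of "x u"]
        by (fastforce simp: V_def algebra_simps)
      have "b * exp (- L * \<tau> u) \<le> b * 1"
        using delay[of u] u \<open>b > 0\<close> by (intro mult_left_mono) (auto simp: L_def)
      then show "b * exp (- L * \<tau> u) + - L + 1 \<le> b + h - c"
        by (simp add: L_def)
    qed (use init[of _ "- L"] zero(3) \<open>\<not> s \<le> 0\<close> r_nonneg \<open>b > 0\<close> delay in auto)
    then show ?thesis
      by (simp add: zero)
  qed
qed


end
section \<open>Separation of the event times\<close>

text \<open>
  The sum of operator norms bounds the speed of the state in terms of the size of the state, the
  delayed state and the sample; the norm of \<open>P B K\<close> bounds the bilinear form in the trigger.  Dividing by the
  coercivity constant \<open>p\<close> of \<open>P\<close> expresses sizes in terms of \<open>V\<close>.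
\<close>

definition gap_constant ::
    "real ^ 'n ^ 'n \<Rightarrow> real ^ 'n ^ 'n \<Rightarrow> real ^ 'm ^ 'n \<Rightarrow> real ^ 'n ^ 'm \<Rightarrow> real ^ 'n ^ 'n \<Rightarrow> real \<Rightarrow> real"
  where "gap_constant A1 A2 B K P p =
    2 * (onorm ((*v) A1) + onorm ((*v) A2) + onorm ((*v) (B ** K))) * onorm ((*v) (P ** B ** K)) / p"

lemma onorm_matrix_nonneg: "onorm ((*v) (M :: real ^ 'n ^ 'm)) \<ge> 0"
  by (intro onorm_pos_le matrix_vector_mul_bounded_linear)

lemma norm_matrix_vector_le: "norm (M *v v) \<le> onorm ((*v) (M :: real ^ 'n ^ 'm)) * norm v"
  by (intro onorm matrix_vector_mul_bounded_linear)

lemma gap_constant_nonneg: "p > 0 \<Longrightarrow> gap_constant A1 A2 B K P p \<ge> 0"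
  unfolding gap_constant_def
  by (intro divide_nonneg_pos mult_nonneg_nonneg add_nonneg_nonneg onorm_matrix_nonneg) auto

context etc_trajectory
begin

text \<open>
  The right-hand side bounds the error term of the trigger at the next event, the left-hand side
  is the level that it has to reach there, both divided by \<open>N\<close>.  Neither side depends
  on the initial function, so the bound is uniform over all trajectories that decay at rate \<open>\<gamma>\<close>.
\<close>

lemma inter_event_gap:
  assumes decay: "\<And>s. -r \<le> s \<Longrightarrow> ereal s < T \<Longrightarrow> V s \<le> N * exp (- \<gamma> * s)"
    and "0 \<le> \<gamma>" "N > 0"
    and p: "p > 0" "\<And>v. p * (norm v)\<^sup>2 \<le> quad_form P v"
    and e: "t k = ereal e" and u: "t (Suc k) = ereal u"
  shows "\<alpha> * exp (- \<beta> * u)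
    \<le> gap_constant A1 A2 B K P p * exp (\<gamma> * r / 2) * exp (- \<gamma> * (e + u) / 2) * (u - e)"
proof -
  let ?a = "onorm ((*v) A1) + onorm ((*v) A2) + onorm ((*v) (B ** K))"
  let ?c = "onorm ((*v) (P ** B ** K))"
  define \<rho> where "\<rho> = sqrt (N / p)"
  have \<rho>: "\<rho> \<ge> 0" "\<rho>\<^sup>2 = N / p"
    using \<open>N > 0\<close> \<open>p > 0\<close> by (simp_all add: \<rho>_def)
  have "e < u" "0 \<le> e" "ereal u < T"
    using t_less_Suc[of k] t_nonneg[of k] t_less_T[of "Suc k"] e u by auto
  have x_bound: "norm (x s) \<le> \<rho> * exp (- \<gamma> * s / 2)" if "-r \<le> s" "s \<le> u" for s
  proof (rule power2_le_imp_le)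
    have "ereal s < T"
      using that \<open>ereal u < T\<close> by (meson ereal_less_eq(3) le_less_trans)
    then have "p * (norm (x s))\<^sup>2 \<le> N * exp (- \<gamma> * s)"
      using p(2)[of "x s"] decay[of s] that by (simp add: V_def)
    moreover have "(exp (- \<gamma> * s / 2))\<^sup>2 = exp (- \<gamma> * s)"
      using exp_double[of "- \<gamma> * s / 2"] by simp
    ultimately show "(norm (x s))\<^sup>2 \<le> (\<rho> * exp (- \<gamma> * s / 2))\<^sup>2"
      using \<open>p > 0\<close> by (simp add: power_mult_distrib \<rho>(2) field_simps)
  qed (use \<rho> in simp)
  \<comment> \<open>The delayed state on the interval between the events belongs to times from \<open>e - r\<close> on,
    hence the shift of the argument.\<close>
  define v where "v = \<rho> * exp (- \<gamma> * (e - r) / 2)"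
  have x_le_v: "norm (x s) \<le> v" if "e - r \<le> s" "s \<le> u" for s
  proof -
    have "\<gamma> * (e - r) \<le> \<gamma> * s"
      using that \<open>0 \<le> \<gamma>\<close> by (intro mult_left_mono)
    then have "\<rho> * exp (- \<gamma> * s / 2) \<le> v"
      unfolding v_def using \<rho>(1) by (intro mult_left_mono) auto
    then show ?thesis
      using x_bound[of s] that \<open>0 \<le> e\<close> by simp
  qed
  have "v \<ge> 0"
    using \<rho>(1) by (simp add: v_def)
  let ?g = "\<lambda>s. A1 *v x s + A2 *v x (s - \<tau> s) + B *v (K *v sample k)"
  have velocity: "norm (?g s) \<le> ?a * v" if "e < s" "s < u" for s
  proof -
    have "norm (M *v x w) \<le> onorm ((*v) M) * v" if "e - r \<le> w" "w \<le> u" for M :: "real ^ 'n ^ 'n" and w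
      using that by (intro order_trans[OF norm_matrix_vector_le] mult_left_mono x_le_v onorm_matrix_nonneg)
    moreover have "norm (B *v (K *v sample k)) \<le> onorm ((*v) (B ** K)) * v"
      unfolding matrix_vector_mul_assoc using \<open>e < u\<close> r_nonneg e
      by (intro order_trans[OF norm_matrix_vector_le] mult_left_mono onorm_matrix_nonneg)
        (simp add: sample_def x_le_v)
    moreover have "\<tau> s \<in> {0..r}"
      using delay[of s] that \<open>0 \<le> e\<close> by simp
    ultimately show ?thesis
      using that r_nonneg unfolding distrib_right
      by (intro order_trans[OF norm_triangle_ineq] add_mono) auto
  qed
  have "norm (x u - x e) \<le> ?a * v * (u - e)"
  proof -
    have "continuous_on {e..u} x"
      using \<open>0 \<le> e\<close> r_nonneg \<open>ereal u < T\<close>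
      by (intro continuous_on_subset[OF x_continuous]) (auto intro: le_less_trans[of _ "ereal u"])
    moreover have "(x has_derivative (\<lambda>d. d *\<^sub>R ?g s)) (at s)" if "e < s" "s < u" for s
    proof -
      have "(x has_vector_derivative ?g s) (at s within {e..<u})"
        using x_derivative[of k s] that e u by (simp add: atLeastLessThan_def atLeast_def lessThan_def Int_def)
      then have "(x has_vector_derivative ?g s) (at s within {e<..<u})"
        by (rule has_vector_derivative_within_subset) auto
      then show ?thesis
        using that at_within_open[of s "{e<..<u}"] by (simp add: has_vector_derivative_def)
    qed
    ultimately obtain s where s: "e < s" "s < u" "norm (x u - x e) \<le> norm ((u - e) *\<^sub>R ?g s)"
      using mvt_general[of e u x "\<lambda>s d. d *\<^sub>R ?g s"] \<open>e < u\<close> by auto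
    note s(3)
    also have "norm ((u - e) *\<^sub>R ?g s) = norm (?g s) * (u - e)"
      using \<open>e < u\<close> by simp
    also have "\<dots> \<le> ?a * v * (u - e)"
      using velocity[OF s(1,2)] \<open>e < u\<close> by (intro mult_right_mono) auto
    finally show ?thesis .
  qed
  then have err: "norm (sample k - x u) \<le> ?a * v * (u - e)"
    by (simp add: sample_def e norm_minus_commute)
  have "\<alpha> * N * exp (- \<beta> * u) \<le> 2 * (x u \<bullet> ((P ** B ** K) *v (sample k - x u)))"
    using triggered[OF u] mult_nonneg_nonneg[OF \<sigma>_nonneg V_nonneg[of u]]
    by (simp add: trigger_fun_def V_def)
  also have "\<dots> \<le> 2 * ((\<rho> * exp (- \<gamma> * u / 2)) * (?c * (?a * v * (u - e))))"
  proof (intro mult_left_mono order_trans[OF norm_cauchy_schwarz] mult_mono)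
    show "norm (x u) \<le> \<rho> * exp (- \<gamma> * u / 2)"
      using x_bound[of u] \<open>e < u\<close> \<open>0 \<le> e\<close> r_nonneg by simp
    show "norm ((P ** B ** K) *v (sample k - x u)) \<le> ?c * (?a * v * (u - e))"
      by (intro order_trans[OF norm_matrix_vector_le] mult_left_mono err onorm_matrix_nonneg)
  qed (use \<rho> in auto)
  also have "\<dots> = \<rho>\<^sup>2 * (2 * ?a * ?c * (exp (- \<gamma> * u / 2) * exp (- \<gamma> * (e - r) / 2)) * (u - e))"
    by (simp add: v_def power2_eq_square)
  also have "exp (- \<gamma> * u / 2) * exp (- \<gamma> * (e - r) / 2) = exp (\<gamma> * r / 2) * exp (- \<gamma> * (e + u) / 2)"
    unfolding exp_add[symmetric] by (rule arg_cong[where f = exp]) (simp add: field_simps)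
  finally have "N * (\<alpha> * exp (- \<beta> * u))
    \<le> N * (2 * ?a * ?c / p * (exp (\<gamma> * r / 2) * exp (- \<gamma> * (e + u) / 2)) * (u - e))"
    by (simp add: \<rho>(2) mult_ac)
  then have "\<alpha> * exp (- \<beta> * u)
    \<le> 2 * ?a * ?c / p * (exp (\<gamma> * r / 2) * exp (- \<gamma> * (e + u) / 2)) * (u - e)"
    using \<open>N > 0\<close> by (simp only: mult_le_cancel_left_pos)
  then show ?thesis
    by (simp add: gap_constant_def mult_ac)
qed

text \<open>
  If \<open>T\<close> were finite, the threshold would stay above \<open>\<alpha> N exp (- \<beta> T)\<close> and every inter-event
  time would exceed a fixed positive number, so that the infinitely many events would not fit
  into \<open>[0, T]\<close>.
\<close>

lemma T_infinite:
  assumes decay: "\<And>s. -r \<le> s \<Longrightarrow> ereal s < T \<Longrightarrow> V s \<le> N * exp (- \<gamma> * s)"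
    and "0 \<le> \<gamma>" "0 \<le> \<beta>"
  shows "T = \<infinity>"
proof (rule ccontr)
  assume "T \<noteq> \<infinity>"
  then obtain T' where T': "T = ereal T'"
    using T_pos by (cases T) auto
  have "N > 0"
    using zero_initial(2) N_pos \<open>T \<noteq> \<infinity>\<close> by blast
  obtain p where p: "p > 0" "\<And>v. p * (norm v)\<^sup>2 \<le> quad_form P v"
    using pos_def_coercive[OF P] by blast
  define C where "C = gap_constant A1 A2 B K P p * exp (\<gamma> * r / 2)"
  have "C \<ge> 0"
    unfolding C_def using gap_constant_nonneg[OF p(1)] by (intro mult_nonneg_nonneg) auto
  define e where "e k = real_of_ereal (t k)" for k
  have e: "t k = ereal (e k)" for k
    using t_nonneg[of k] t_le_T[of k] T' by (cases "t k") (auto simp: e_def)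
  have gap: "\<alpha> * exp (- \<beta> * T') \<le> C * (e (Suc k) - e k)" for k
  proof -
    have ek: "0 \<le> e k" "e k < e (Suc k)" "e (Suc k) \<le> T'"
      using t_nonneg[of k] t_less_Suc[of k] t_le_T[of "Suc k"] by (auto simp: e T')
    have "\<alpha> * exp (- \<beta> * T') \<le> \<alpha> * exp (- \<beta> * e (Suc k))"
      using \<alpha>_pos ek \<open>0 \<le> \<beta>\<close> by (intro mult_left_mono) (auto intro: mult_left_mono)
    also have "\<dots> \<le> C * exp (- \<gamma> * (e k + e (Suc k)) / 2) * (e (Suc k) - e k)"
      unfolding C_def by (rule inter_event_gap[OF decay \<open>0 \<le> \<gamma>\<close> \<open>N > 0\<close> p e e])
    also have "\<dots> \<le> C * 1 * (e (Suc k) - e k)"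
      using ek \<open>C \<ge> 0\<close> \<open>0 \<le> \<gamma>\<close> by (intro mult_right_mono mult_left_mono) auto
    finally show ?thesis
      by simp
  qed
  have "real k * (\<alpha> * exp (- \<beta> * T')) \<le> C * e k" for k
  proof (induction k)
    case (Suc k)
    then show ?case
      using gap[of k] by (simp add: algebra_simps)
  qed (simp add: e_def t_0)
  moreover have "C * e k \<le> C * T'" for k
    using t_le_T[of k] \<open>C \<ge> 0\<close> by (intro mult_left_mono) (auto simp: e T')
  ultimately have "real k * (\<alpha> * exp (- \<beta> * T')) \<le> C * T'" for k
    by (meson order_trans)
  moreover have "\<alpha> * exp (- \<beta> * T') > 0"
    using \<alpha>_pos by simp
  ultimately show False
    using reals_Archimedean3[of "\<alpha> * exp (- \<beta> * T')"] by (metis not_less)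
qed

lemma not_zeno:
  assumes "T = \<infinity>"
  shows "\<not> zeno t"
proof
  assume "zeno t"
  then obtain a c :: real where inf: "infinite {k. ereal a \<le> t k \<and> t k \<le> ereal c}"
    by (auto simp: zeno_def)
  have "t k \<le> ereal c" for k
  proof -
    obtain j where "j \<ge> k" "t j \<le> ereal c"
      using inf unfolding infinite_nat_iff_unbounded_le by blast
    then show ?thesis
      using incseqD[OF incseq_t] order_trans by blast
  qed
  then have "T \<le> ereal c"
    by (auto simp: T_def intro: SUP_least)
  then show False
    using assms by simp
qed

text \<open>
  With \<open>\<gamma> = \<beta>\<close> the estimate becomes \<open>\<alpha> exp (- \<beta> \<delta> / 2) \<le> C \<delta>\<close> for \<open>\<delta>\<close> the inter-event time, in
  which absolute time no longer occurs.  For \<open>\<delta> < 1\<close> the left-hand side is at least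
  \<open>\<alpha> exp (- \<beta> / 2)\<close>.  The summand \<open>1\<close> in the denominator avoids a division by zero when the
  feedback gain vanishes.
\<close>

lemma inter_event_time_ge:
  assumes decay: "\<And>s. -r \<le> s \<Longrightarrow> ereal s < T \<Longrightarrow> V s \<le> N * exp (- \<beta> * s)"
    and "0 \<le> \<beta>"
    and p: "p > 0" "\<And>v. p * (norm v)\<^sup>2 \<le> quad_form P v"
    and "t k < \<infinity>"
  shows "t (Suc k) - t k
    \<ge> ereal (min 1 (\<alpha> * exp (- \<beta> / 2) / (gap_constant A1 A2 B K P p * exp (\<beta> * r / 2) + 1)))"
    (is "_ \<ge> ereal ?\<Delta>")
proof (cases "t (Suc k)")
  case (real u)
  define C where "C = gap_constant A1 A2 B K P p * exp (\<beta> * r / 2)"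
  have "C \<ge> 0"
    unfolding C_def using gap_constant_nonneg[OF p(1)] by (intro mult_nonneg_nonneg) auto
  obtain e where e: "t k = ereal e"
    using t_nonneg[of k] \<open>t k < \<infinity>\<close> by (cases "t k") auto
  have "N > 0"
    using zero_initial(1)[of k] N_pos real by force
  have "e < u"
    using t_less_Suc[of k] e real by simp
  have "?\<Delta> \<le> u - e"
  proof (rule ccontr)
    assume "\<not> ?\<Delta> \<le> u - e"
    then have short: "u - e < 1" "u - e < \<alpha> * exp (- \<beta> / 2) / (C + 1)"
      by (auto simp: C_def)
    have "\<alpha> * exp (- \<beta> * u) \<le> C * exp (- \<beta> * (e + u) / 2) * (u - e)"
      unfolding C_def by (rule inter_event_gap[OF decay \<open>0 \<le> \<beta>\<close> \<open>N > 0\<close> p e real])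
    moreover have "exp (- \<beta> * u) = exp (- \<beta> * (u - e) / 2) * exp (- \<beta> * (e + u) / 2)"
      unfolding exp_add[symmetric] by (rule arg_cong[where f = exp]) (simp add: field_simps)
    ultimately have "(\<alpha> * exp (- \<beta> * (u - e) / 2)) * exp (- \<beta> * (e + u) / 2)
        \<le> (C * (u - e)) * exp (- \<beta> * (e + u) / 2)"
      by (simp add: mult_ac)
    then have "\<alpha> * exp (- \<beta> * (u - e) / 2) \<le> C * (u - e)"
      by (simp only: mult_le_cancel_right_pos exp_gt_zero)
    moreover have "\<beta> * (u - e) \<le> \<beta> * 1"
      using short \<open>0 \<le> \<beta>\<close> by (intro mult_left_mono) auto
    then have "\<alpha> * exp (- \<beta> / 2) \<le> \<alpha> * exp (- \<beta> * (u - e) / 2)"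
      using \<alpha>_pos by simp
    moreover have "C * (u - e) \<le> (C + 1) * (u - e)"
      using \<open>e < u\<close> by simp
    ultimately show False
      using short(2) \<open>C \<ge> 0\<close> by (simp add: field_simps)
  qed
  then show ?thesis
    unfolding e real ereal_minus(1) ereal_less_eq(3) .
next
  case PInf
  then show ?thesis
    using t_nonneg[of k] \<open>t k < \<infinity>\<close> by (cases "t k") auto
next
  case MInf
  then show ?thesis
    using t_nonneg[of "Suc k"] by simp
qed

text \<open>
  \<open>V\<close> is quadratic, so passing to norms takes a square root and halves the rate.  Adding \<open>1\<close> to
  the operator norm makes the positivity of the constant immediate.
\<close>

lemma norm_decay:
  assumes decay: "\<And>s. -r \<le> s \<Longrightarrow> ereal s < T \<Longrightarrow> V s \<le> N * exp (- \<gamma> * s)"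
    and p: "p > 0" "\<And>v. p * (norm v)\<^sup>2 \<le> quad_form P v"
    and "-r \<le> s" "ereal s < T"
  shows "norm (x s) \<le> sqrt ((onorm ((*v) P) + 1) / p) * (SUP \<theta>\<in>{-r..0}. norm (\<phi> \<theta>)) * exp (- (\<gamma> / 2) * s)"
proof (rule power2_le_imp_le)
  let ?q = "onorm ((*v) P) + 1"
  define \<Phi> where "\<Phi> = (SUP \<theta>\<in>{-r..0}. norm (\<phi> \<theta>))"
  have q: "?q > 0"
    using onorm_matrix_nonneg[of P] by simp
  have \<Phi>: "norm (\<phi> \<theta>) \<le> \<Phi>" if "\<theta> \<in> {-r..0}" for \<theta>
    unfolding \<Phi>_def using that \<phi>_continuous
    by (intro cSUP_upper bounded_imp_bdd_above compact_imp_bounded compact_continuous_image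
        continuous_intros) auto
  have "\<Phi> \<ge> 0"
    using \<Phi>[of 0] r_nonneg norm_ge_zero[of "\<phi> 0"] by (simp del: norm_ge_zero)
  have "N \<le> ?q * \<Phi>\<^sup>2"
    unfolding N_def
  proof (rule cSUP_least)
    fix \<theta> assume "\<theta> \<in> {-r..0}"
    then have "(norm (\<phi> \<theta>))\<^sup>2 \<le> \<Phi>\<^sup>2"
      using \<Phi> by (simp add: power_mono)
    then have "?q * (norm (\<phi> \<theta>))\<^sup>2 \<le> ?q * \<Phi>\<^sup>2"
      using q by simp
    then show "quad_form P (\<phi> \<theta>) \<le> ?q * \<Phi>\<^sup>2"
      using quad_form_le_onorm[of P "\<phi> \<theta>"] zero_le_power2[of "norm (\<phi> \<theta>)"]
      unfolding distrib_right by linarith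
  qed (use r_nonneg in simp)
  then have "N * exp (- \<gamma> * s) \<le> ?q * \<Phi>\<^sup>2 * exp (- \<gamma> * s)"
    by (rule mult_right_mono) simp
  then have "p * (norm (x s))\<^sup>2 \<le> ?q * \<Phi>\<^sup>2 * exp (- \<gamma> * s)"
    using p(2)[of "x s"] decay[OF assms(4,5)] unfolding V_def by linarith
  moreover have "(exp (- (\<gamma> / 2) * s))\<^sup>2 = exp (- \<gamma> * s)"
    using exp_double[of "- (\<gamma> / 2) * s"] by simp
  moreover have "(sqrt (?q / p))\<^sup>2 = ?q / p"
    using q p(1) by simp
  ultimately show "(norm (x s))\<^sup>2 \<le> (sqrt (?q / p) * \<Phi> * exp (- (\<gamma> / 2) * s))\<^sup>2"
    unfolding power_mult_distrib using p(1) by (simp add: field_simps)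
  show "0 \<le> sqrt (?q / p) * \<Phi> * exp (- (\<gamma> / 2) * s)"
    using q p(1) \<open>\<Phi> \<ge> 0\<close> by simp
qed

end

section \<open>The decay rate and the main result\<close>

lemma decay_rate_strict_mono:
  fixes b r \<alpha> l l' :: real
  assumes "b > 0" "r \<ge> 0" "l < l'"
  shows "b * exp (l * r) + l + \<alpha> < b * exp (l' * r) + l' + \<alpha>"
proof -
  have "l * r \<le> l' * r"
    using assms by (intro mult_right_mono) auto
  then have "b * exp (l * r) \<le> b * exp (l' * r)"
    using assms(1) by (intro mult_left_mono) auto
  then show ?thesis
    using assms(3) by linarith
qed

text \<open>
  At \<open>l = 0\<close> the right-hand side is smaller than the left-hand side because
  \<open>h > \<alpha> + \<sigma>\<close>, and at \<open>l = h - \<sigma> - \<alpha>\<close> it is at least as large.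
\<close>

lemma decay_rate_exists:
  fixes b h \<sigma> \<alpha> r :: real
  assumes "b > 0" "r \<ge> 0" "h > \<alpha> + \<sigma>"
  obtains l where "l > 0" "b + h - \<sigma> = b * exp (l * r) + l + \<alpha>"
proof -
  let ?f = "\<lambda>l. b * exp (l * r) + l + \<alpha>"
  have "\<exists>l\<ge>0. l \<le> h - \<sigma> - \<alpha> \<and> ?f l = b + h - \<sigma>"
  proof (rule IVT')
    have "b * 1 \<le> b * exp ((h - \<sigma> - \<alpha>) * r)"
      using assms by (intro mult_left_mono) auto
    then show "b + h - \<sigma> \<le> ?f (h - \<sigma> - \<alpha>)"
      by simp
  qed (use assms in \<open>auto intro!: continuous_intros\<close>)
  then obtain l where "l \<ge> 0" "?f l = b + h - \<sigma>"
    by blast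
  moreover have "l \<noteq> 0"
    using \<open>?f l = b + h - \<sigma>\<close> assms by auto
  ultimately show thesis
    using that[of l] by simp
qed

theorem theorem1:
  fixes A1 A2 Q P :: "real ^ 'n ^ 'n"
    and B :: "real ^ 'm ^ 'n"
    and R K :: "real ^ 'n ^ 'm"
    and \<tau> :: "real \<Rightarrow> real"
    and r b h \<alpha> \<beta> \<sigma> :: real
  assumes "r \<ge> 0"
    and "continuous_on {0..} \<tau>"
    and "\<forall>s \<ge> 0. \<tau> s \<in> {0..r}"
    and "b > 0" and "h > 0"
    and "pos_def Q"
    and "neg_def (block_matrix
           (Q ** transpose A1 + A1 ** Q + transpose R ** transpose B + B ** R + (b + h) *\<^sub>R Q)
           (A2 ** Q)
           (Q ** transpose A2)
           (- (b *\<^sub>R Q)))"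
    and "P = matrix_inv Q"
    and "K = R ** P"
    and "\<alpha> > 0" and "\<sigma> \<ge> 0" and "h > \<alpha> + \<sigma>"
    and "\<beta> > 0"
  shows "globally_exp_stable r (etc_solution A1 A2 B P K \<tau> r \<alpha> \<beta> \<sigma>)
    \<and> (\<forall>\<phi> x t. continuous_on {-r..0} \<phi> \<and> etc_solution A1 A2 B P K \<tau> r \<alpha> \<beta> \<sigma> \<phi> x t
          \<longrightarrow> \<not> zeno t)
    \<and> (\<exists>!l::real. b + h - \<sigma> = b * exp (l * r) + l + \<alpha>)
    \<and> (\<forall>l::real. b + h - \<sigma> = b * exp (l * r) + l + \<alpha> \<and> \<beta> \<le> l \<longrightarrow>
          (\<exists>\<Delta> > 0. \<forall>\<phi> x t.
             continuous_on {-r..0} \<phi> \<and> etc_solution A1 A2 B P K \<tau> r \<alpha> \<beta> \<sigma> \<phi> x t \<longrightarrow>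
               (\<forall>k. t k < \<infinity> \<longrightarrow> t (Suc k) - t k \<ge> ereal \<Delta>)))"
proof -
  let ?sol = "etc_solution A1 A2 B P K \<tau> r \<alpha> \<beta> \<sigma>"
  note diss = lmi_dissipation[OF assms(6-9)]
  have P: "pos_def P"
    using pos_def_matrix_inv(3)[OF \<open>pos_def Q\<close>] assms(8) by simp
  have trajectory: "etc_trajectory A1 A2 P B K \<tau> r \<alpha> \<beta> \<sigma> \<phi> x t"
    if "continuous_on {-r..0} \<phi>" "?sol \<phi> x t" for \<phi> x t
    using that assms P by unfold_locales auto
  obtain p where p: "p > 0" "\<And>v. p * (norm v)\<^sup>2 \<le> quad_form P v"
    using pos_def_coercive[OF P] by blast
  obtain l where l: "l > 0" "b + h - \<sigma> = b * exp (l * r) + l + \<alpha>"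
    using decay_rate_exists[OF \<open>b > 0\<close> \<open>r \<ge> 0\<close> \<open>h > \<alpha> + \<sigma>\<close>] by blast
  have rate: "b * exp (\<gamma> * r) + \<gamma> + \<alpha> \<le> b + h - \<sigma>"
    if "\<gamma> \<le> l'" "b + h - \<sigma> = b * exp (l' * r) + l' + \<alpha>" for \<gamma> l'
    using decay_rate_strict_mono[OF \<open>b > 0\<close> \<open>r \<ge> 0\<close>, of \<gamma> l' \<alpha>] that by (cases "\<gamma> = l'") auto
  define \<gamma> where "\<gamma> = min \<beta> l"
  have \<gamma>: "\<gamma> > 0" "\<gamma> \<le> \<beta>" "b * exp (\<gamma> * r) + \<gamma> + \<alpha> \<le> b + h - \<sigma>"
    using l \<open>\<beta> > 0\<close> rate[of \<gamma> l] by (auto simp: \<gamma>_def)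
  have T: "(SUP k. t k) = \<infinity>" and no_zeno: "\<not> zeno t"
    and bound: "\<And>s. s \<ge> 0 \<Longrightarrow> norm (x s)
      \<le> sqrt ((onorm ((*v) P) + 1) / p) * (SUP \<theta>\<in>{-r..0}. norm (\<phi> \<theta>)) * exp (- (\<gamma> / 2) * s)"
    if sol: "continuous_on {-r..0} \<phi>" "?sol \<phi> x t" for \<phi> x t
  proof -
    interpret etc_trajectory A1 A2 P B K \<tau> r \<alpha> \<beta> \<sigma> \<phi> x t
      by (rule trajectory[OF sol])
    note decay = V_decay[OF diss \<open>b > 0\<close> less_imp_le[OF \<gamma>(1)] \<gamma>(2,3)]
    have "T = \<infinity>"
      using T_infinite[OF decay] \<gamma>(1) \<open>\<beta> > 0\<close> by simp
    then show "(SUP k. t k) = \<infinity>" "\<not> zeno t"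
      using not_zeno by (auto simp: T_def)
    show "norm (x s) \<le> sqrt ((onorm ((*v) P) + 1) / p) * (SUP \<theta>\<in>{-r..0}. norm (\<phi> \<theta>)) * exp (- (\<gamma> / 2) * s)"
      if "s \<ge> 0" for s
      using norm_decay[OF decay p] that \<open>T = \<infinity>\<close> \<open>r \<ge> 0\<close> by simp
  qed
  have "globally_exp_stable r ?sol"
    unfolding globally_exp_stable_def
  proof (intro exI conjI allI impI)
    show "sqrt ((onorm ((*v) P) + 1) / p) > 0"
      using onorm_matrix_nonneg[of P] p(1) by simp
    show "\<gamma> / 2 > 0"
      using \<gamma> by simp
  qed (use T bound in auto)
  moreover have "\<exists>!l. b + h - \<sigma> = b * exp (l * r) + l + \<alpha>"
  proof (rule ex1I[of _ l])
    show "l' = l" if "b + h - \<sigma> = b * exp (l' * r) + l' + \<alpha>" for l'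
      using decay_rate_strict_mono[OF \<open>b > 0\<close> \<open>r \<ge> 0\<close>, of l l' \<alpha>]
        decay_rate_strict_mono[OF \<open>b > 0\<close> \<open>r \<ge> 0\<close>, of l' l \<alpha>] that l(2)
      by (cases l l' rule: linorder_cases) auto
  qed (rule l)
  moreover have "\<exists>\<Delta> > 0. \<forall>\<phi> x t. continuous_on {-r..0} \<phi> \<and> ?sol \<phi> x t \<longrightarrow>
      (\<forall>k. t k < \<infinity> \<longrightarrow> t (Suc k) - t k \<ge> ereal \<Delta>)"
    if l': "b + h - \<sigma> = b * exp (l' * r) + l' + \<alpha>" "\<beta> \<le> l'" for l'
  proof (intro exI conjI allI impI; (elim conjE)?)
    let ?C = "gap_constant A1 A2 B K P p * exp (\<beta> * r / 2)"
    have "?C \<ge> 0"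
      using gap_constant_nonneg[OF p(1)] by (intro mult_nonneg_nonneg) auto
    then show "0 < min 1 (\<alpha> * exp (- \<beta> / 2) / (?C + 1))"
      using \<open>\<alpha> > 0\<close> by simp
    fix \<phi> x t k
    assume sol: "continuous_on {-r..0} \<phi>" "?sol \<phi> x t" and "t k < \<infinity>"
    interpret etc_trajectory A1 A2 P B K \<tau> r \<alpha> \<beta> \<sigma> \<phi> x t
      by (rule trajectory[OF sol])
    have \<beta>: "0 \<le> \<beta>"
      using \<open>\<beta> > 0\<close> by simp
    note decay = V_decay[OF diss \<open>b > 0\<close> \<beta> order_refl rate[OF l'(2,1)]]
    show "ereal (min 1 (\<alpha> * exp (- \<beta> / 2) / (?C + 1))) \<le> t (Suc k) - t k"
      by (rule inter_event_time_ge[OF decay \<beta> p \<open>t k < \<infinity>\<close>])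
  qed
  ultimately show ?thesis
    using no_zeno by blast
qed

end
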